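(* Let $M=2^{2\lambda}$ with $\lambda$ a positive integer, and let the $\sqrt M$-PAM signal set be labelled from left to right by $0,1,\dots,\sqrt M-1$, the label $n$ denoting the point $-(\sqrt M-1)+2n$. Then a left-cyclic Latin Square of order $\sqrt M$, with rows indexed by the label of the symbol of node A and columns by the label of the symbol of node B, removes the singular fade state $z=1$ for the $\sqrt M$-PAM signal set.
   Context: The symmetric $\sqrt M$-PAM signal set is $\mathcal{S}=\{-(\sqrt M-1)+2n : n=0,1,\dots,\sqrt M-1\}$. A Latin Square of order $N$ with symbols from a finite set is an $N\times N$ array in which each cell contains one symbol and each symbol occurs at most once in each row and each column. A left-cyclic Latin Square is a Latin Square in which each row is obtained from the previous row by a left cyclic shift by one position. A fade state is a nonzero complex number $z$; it is a singular fade state for $\mathcal{S}$ if $\{x+z y : x,y\in\mathcal{S}\}$ has fewer than $|\mathcal{S}|^2$ elements. A Latin Square $L$ with rows and columns indexed by (labels of) $\mathcal{S}$ removes the singular fade state $z$ if $$\min\{|(x_A-x_A')+z(x_B-x_B')| : (x_A,x_B),(x_A',x_B')\in\mathcal{S}^2,\ L(x_A,x_B)\ne L(x_A',x_B')\}>0;$$ equivalently, any two pairs in $\mathcal{S}^2$ with $x_A+zx_B=x_A'+zx_B'$ hold the same symbol in $L$. *)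

theory Defs
  imports Complex_Main
begin

definition pam_point :: "nat \<Rightarrow> nat \<Rightarrow> complex" where
  "pam_point N n = - (of_nat N - 1) + 2 * of_nat n"

definition pam_set :: "nat \<Rightarrow> complex set" where
  "pam_set N = {pam_point N n | n. n < N}"

definition singular_fade_state :: "complex set \<Rightarrow> complex \<Rightarrow> bool" where
  "singular_fade_state S z \<longleftrightarrow>
     z \<noteq> 0 \<and> card {x + z * y | x y. x \<in> S \<and> y \<in> S} < (card S)\<^sup>2"

(* Rows and columns are numbered 0, ..., N - 1; only the values L i j with i, j < N matter. *)
definition latin_square :: "nat \<Rightarrow> 's set \<Rightarrow> (nat \<Rightarrow> nat \<Rightarrow> 's) \<Rightarrow> bool" where
  "latin_square N T L \<longleftrightarrow>
     finite T \<and>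
     (\<forall>i<N. \<forall>j<N. L i j \<in> T) \<and>
     (\<forall>i<N. inj_on (\<lambda>j. L i j) {..<N}) \<and>
     (\<forall>j<N. inj_on (\<lambda>i. L i j) {..<N})"

definition left_cyclic_latin_square :: "nat \<Rightarrow> 's set \<Rightarrow> (nat \<Rightarrow> nat \<Rightarrow> 's) \<Rightarrow> bool" where
  "left_cyclic_latin_square N T L \<longleftrightarrow>
     latin_square N T L \<and>
     (\<forall>i. Suc i < N \<longrightarrow> map (L (Suc i)) [0..<N] = rotate1 (map (L i) [0..<N]))"

(* The label n < N denotes the point p n; a and a' are labels of node A (rows of L), b and b'
   labels of node B (columns of L).  For N >= 2 the set below is finite and, if L is a Latin
   square, nonempty, so that Min is its actual minimum. *)
definition removes_fade_state ::
  "nat \<Rightarrow> (nat \<Rightarrow> complex) \<Rightarrow> (nat \<Rightarrow> nat \<Rightarrow> 's) \<Rightarrow> complex \<Rightarrow> bool" where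
  "removes_fade_state N p L z \<longleftrightarrow>
     Min {norm ((p a - p a') + z * (p b - p b')) | a b a' b'.
            a < N \<and> b < N \<and> a' < N \<and> b' < N \<and> L a b \<noteq> L a' b'} > 0"

end

theory Submission
  imports Defs
begin

text \<open>
  Shifting each row left by one gives \<open>L i j = L 0 ((i + j) mod N)\<close>, while two pairs of labels
  have the same image \<open>x\<^sub>A + x\<^sub>B\<close> exactly when their label sums agree. Since label sums take only
  \<open>2 N - 1 < N\<^sup>2\<close> values, \<open>z = 1\<close> is singular.
\<close>

lemma left_cyclic_entry:
  assumes "left_cyclic_latin_square N T L" "i < N" "j < N"
  shows "L i j = L 0 ((i + j) mod N)"
  using assms(2,3)
proof (induction i arbitrary: j)
  case 0
  then show ?case by simp
next
  case (Suc i)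
  have "map (L (Suc i)) [0..<N] ! j = rotate1 (map (L i) [0..<N]) ! j"
    using assms(1) Suc.prems by (simp add: left_cyclic_latin_square_def)
  \<comment> \<open>Position \<open>j\<close> of a list rotated by one is position
    \<open>Suc j mod N\<close> of the original; the wrap-around brings in \<open>mod N\<close>. The
    column changes, hence the induction over arbitrary \<open>j\<close>.\<close>
  then have "L (Suc i) j = L i (Suc j mod N)"
    using Suc.prems by (simp add: nth_rotate1)
  also have "\<dots> = L 0 ((i + Suc j mod N) mod N)"
    using Suc.prems by (intro Suc.IH) auto
  finally show ?case
    by (simp add: mod_add_right_eq)
qed

text \<open>The offsets \<open>- (N - 1)\<close> cancel, so at \<open>z = 1\<close> the distance
  between two pairs depends only on their label sums.\<close>

lemma pam_point_diff_add_diff: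
  "(pam_point N a - pam_point N a') + (pam_point N b - pam_point N b')
    = 2 * (of_nat (a + b) - of_nat (a' + b'))"
  by (simp add: pam_point_def algebra_simps)

lemma card_pam_set: "card (pam_set N) = N"
proof -
  have "pam_set N = pam_point N ` {..<N}"
    by (auto simp: pam_set_def)
  moreover have "inj_on (pam_point N) {..<N}"
    by (auto simp: inj_on_def pam_point_def)
  ultimately show ?thesis
    by (simp add: card_image)
qed

lemma singular_fade_state_pam_one:
  assumes "N \<ge> 2"
  shows "singular_fade_state (pam_set N) 1"
proof -
  \<comment> \<open>\<open>s k\<close> is the sum of any two points whose labels add up to
    \<open>k\<close>; each point contributes one offset \<open>- (N - 1)\<close>.\<close>
  define s where "s k = (2 * of_nat k - 2 * (of_nat N - 1) :: complex)" for k :: nat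
  have "{x + 1 * y | x y. x \<in> pam_set N \<and> y \<in> pam_set N} \<subseteq> s ` {..<2 * N - 1}"
  proof clarify
    fix x y assume "x \<in> pam_set N" "y \<in> pam_set N"
    then obtain a b where ab: "x = pam_point N a" "y = pam_point N b" "a < N" "b < N"
      by (auto simp: pam_set_def)
    then have "x + 1 * y = s (a + b)"
      by (simp add: pam_point_def s_def)
    \<comment> \<open>The largest label sum is \<open>2 * (N - 1)\<close>, so
      \<open>2 * N - 1\<close> sums are possible.\<close>
    moreover have "a + b < 2 * N - 1"
      using ab by linarith
    ultimately show "x + 1 * y \<in> s ` {..<2 * N - 1}"
      by blast
  qed
  then have "card {x + 1 * y | x y. x \<in> pam_set N \<and> y \<in> pam_set N} \<le> 2 * N - 1"
    using surj_card_le[of "{..<2 * N - 1}" _ s] by simp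
  also have "\<dots> < 2 * N"
    using assms by simp
  also have "\<dots> \<le> N\<^sup>2"
    using assms by (simp add: power2_eq_square)
  finally show ?thesis
    by (simp add: singular_fade_state_def card_pam_set)
qed

lemma removes_fade_state_pam_one:
  assumes "N \<ge> 2" "left_cyclic_latin_square N T L"
  shows "removes_fade_state N (pam_point N) L 1"
proof -
  define d where "d = (\<lambda>(a, b, a', b').
    norm ((pam_point N a - pam_point N a') + 1 * (pam_point N b - pam_point N b')))"
  define Q where "Q = {(a, b, a', b'). a < N \<and> b < N \<and> a' < N \<and> b' < N \<and> L a b \<noteq> L a' b'}"
  have "Q \<subseteq> {..<N} \<times> {..<N} \<times> {..<N} \<times> {..<N}"
    by (auto simp: Q_def)
  then have "finite Q"
    by (rule finite_subset) simp
  have "inj_on (L 0) {..<N}"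
    using assms by (simp add: left_cyclic_latin_square_def latin_square_def)
  \<comment> \<open>Two distinct symbols in row 0 witness that \<open>Q\<close> is nonempty; column
    1 exists because \<open>N \<ge> 2\<close>.\<close>
  then have "L 0 0 \<noteq> L 0 1"
    using assms(1) by (auto dest: inj_onD)
  then have "(0, 0, 0, 1) \<in> Q"
    using assms(1) by (simp add: Q_def)
  have "0 < d q" if "q \<in> Q" for q
  proof -
    obtain a b a' b' where q: "q = (a, b, a', b')" and lt: "a < N" "b < N" "a' < N" "b' < N"
      and ne: "L a b \<noteq> L a' b'"
      using \<open>q \<in> Q\<close> by (auto simp: Q_def)
    \<comment> \<open>Equal label sums would lead both cells to the same entry of row 0.\<close>
    have "a + b \<noteq> a' + b'"
      using ne lt left_cyclic_entry[OF assms(2)] by metis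
    then have "(of_nat (a + b) :: complex) \<noteq> of_nat (a' + b')"
      by (simp only: of_nat_eq_iff not_False_eq_True)
    then show ?thesis
      by (simp add: q d_def pam_point_diff_add_diff del: of_nat_add)
  qed
  moreover have "d ` Q \<noteq> {}"
    using \<open>(0, 0, 0, 1) \<in> Q\<close> by blast
  ultimately have "0 < Min (d ` Q)"
    using \<open>finite Q\<close> by simp
  moreover have "{norm ((pam_point N a - pam_point N a') + 1 * (pam_point N b - pam_point N b'))
      | a b a' b'. a < N \<and> b < N \<and> a' < N \<and> b' < N \<and> L a b \<noteq> L a' b'} = d ` Q"
    by (rule set_eqI) (simp add: d_def Q_def image_iff Bex_def, blast)
  ultimately show ?thesis
    by (simp only: removes_fade_state_def)
qed

theorem lemma7:
  fixes l M N :: nat and T :: "'s set" and L :: "nat \<Rightarrow> nat \<Rightarrow> 's"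
  assumes "l > 0"
    and "M = 2 ^ (2 * l)"
    and "real N = sqrt (real M)"
    and "left_cyclic_latin_square N T L"
  shows "singular_fade_state (pam_set N) 1 \<and> removes_fade_state N (pam_point N) L 1"
proof -
  have "real M = (2 ^ l)\<^sup>2"
    using assms(2) by (simp add: power_mult mult.commute flip: power_mult)
  then have "real N = real (2 ^ l)"
    using assms(3) by simp
  then have "N = 2 ^ l"
    by (simp only: of_nat_eq_iff)
  \<comment> \<open>Positivity of \<open>l\<close> excludes order 1, where no two cells
    differ.\<close>
  then have "N \<ge> 2"
    using assms(1) self_le_power[of "2 :: nat" l] by simp
  then show ?thesis
    using singular_fade_state_pam_one removes_fade_state_pam_one assms(4) by blast
qed

end
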